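(* Let $f:\mathbb{Z}^+\to\mathbb{C}$ be a bounded arithmetic function, let $a_1,\dots,a_N\in\mathbb{C}$, and let $\phi:\mathbb{R}\to\mathbb{R}$ be a smooth function with $\phi(x)=0$ for $x<1$ and $\phi(x)=1$ for $x>2$. Define, for $x\ge1$, \[ F(x)=\phi(x)\sum_{n=1}^N a_n e(nx),\qquad G(x)=\sum_{n\le x} f(n)F\Big(\frac xn\Big), \] and set \[ \mathcal{B}=\sum_{n=1}^N b_n,\qquad b_n=a_n\sum_{d\mid n}f(d). \] Consider $R\to\infty$ (with $N$ and the $a_n$ allowed to depend on $R$), and assume $R\ge 4N$, $b_n\ge0$ for all $n$, and that for some $K>1$ and every $V>1/6$ \[ \sum_{\frac R{2V}\le d\le 3R}\ \sum_{\frac{dV}{R}\le r<\frac{2dV}{R}}\ \sum_{\substack{1\le n\le N\\ n\equiv \pm r \ (\mathrm{mod}\ d)}} |a_n| = o\big((6V)^K\mathcal{B}\big). \] Then \[ \int_R^{2R}|G(x)|^2\,dx \gg R\,\mathcal{B}^2N^{-1}. \] In particular, $G(x)=\Omega\big(\mathcal{B}N^{-1/2}\big)$.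
   Context: $e(x)=e^{2\pi i x}$. $A\gg B$ means $B=O(|A|)$; $A=\Omega(B)$ means that $A=o(B)$ fails.
   Formalization: The Ω claim is proved assuming that 𝓑 is nonzero for arbitrarily large R (with all a_n = 0 it is false as written) and for x in [R,2R]; the o-hypothesis is taken uniformly in V > 1/6, and N ≥ 1. *)

theory Defs
  imports "HOL-Analysis.Analysis" "HOL-Library.Landau_Symbols" "HOL-Number_Theory.Cong"
begin

definition ee :: "real \<Rightarrow> complex" where
  "ee x = exp (2 * of_real pi * \<i> * of_real x)"

definition smooth :: "(real \<Rightarrow> real) \<Rightarrow> bool" where
  "smooth \<phi> \<longleftrightarrow> (\<forall>k x. ((deriv ^^ k) \<phi>) differentiable (at x))"

definition Fsum :: "(real \<Rightarrow> real) \<Rightarrow> nat \<Rightarrow> (nat \<Rightarrow> complex) \<Rightarrow> real \<Rightarrow> complex" where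
  "Fsum \<phi> N a x = of_real (\<phi> x) * (\<Sum>n=1..N. a n * ee (real n * x))"

definition Gsum ::
  "(nat \<Rightarrow> complex) \<Rightarrow> (real \<Rightarrow> real) \<Rightarrow> nat \<Rightarrow> (nat \<Rightarrow> complex) \<Rightarrow> real \<Rightarrow> complex" where
  "Gsum f \<phi> N a x = (\<Sum>n\<in>{n. 1 \<le> n \<and> real n \<le> x}. f n * Fsum \<phi> N a (x / real n))"

definition bcoef :: "(nat \<Rightarrow> complex) \<Rightarrow> (nat \<Rightarrow> complex) \<Rightarrow> nat \<Rightarrow> complex" where
  "bcoef f a n = a n * (\<Sum>d\<in>{d. d dvd n}. f d)"

definition Bsum :: "(nat \<Rightarrow> complex) \<Rightarrow> nat \<Rightarrow> (nat \<Rightarrow> complex) \<Rightarrow> complex" where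
  "Bsum f N a = (\<Sum>n=1..N. bcoef f a n)"

definition near_multiple_sum :: "nat \<Rightarrow> (nat \<Rightarrow> complex) \<Rightarrow> real \<Rightarrow> real \<Rightarrow> real" where
  "near_multiple_sum N a R V =
     (\<Sum>d\<in>{d::nat. R / (2 * V) \<le> real d \<and> real d \<le> 3 * R}.
       \<Sum>r\<in>{r::nat. real d * V / R \<le> real r \<and> real r < 2 * real d * V / R}.
         \<Sum>n\<in>{n\<in>{1..N}. [int n = int r] (mod int d) \<or> [int n = - int r] (mod int d)}.
           cmod (a n))"

text \<open>
  The filter on pairs \<open>(R, y)\<close> for ``\<open>R \<rightarrow> \<infinity>\<close>, uniformly in \<open>y \<in> S R\<close>''.
\<close>
definition unif_at_top :: "(real \<Rightarrow> real set) \<Rightarrow> (real \<times> real) filter" where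
  "unif_at_top S = inf (filtercomap fst at_top) (principal (SIGMA R:UNIV. S R))"

lemma eventually_unif_at_top:
  "eventually P (unif_at_top S) \<longleftrightarrow> (\<forall>\<^sub>F R in at_top. \<forall>y\<in>S R. P (R, y))"
  unfolding unif_at_top_def eventually_inf_principal eventually_filtercomap
  by (auto elim: eventually_mono intro!: exI[of _ "\<lambda>R. \<forall>y\<in>S R. P (R, y)"])

end

theory Submission
  imports Defs
begin

text \<open>
  Test \<open>G\<close> on \<open>[R, 2R]\<close> against \<open>w(x/R) \<Sum>\<^sub>k\<^sub>\<le>\<^sub>N e(-kx)\<close>, where \<open>w(t) = ((t-1)(2-t))\<^sup>j\<close> vanishes to order
  \<open>j \<ge> K + 1\<close> at both ends of \<open>[1, 2]\<close>. A term \<open>f(d) a\<^sub>n \<phi>(x/d) e(nx/d)\<close> of \<open>G\<close> resonates with \<open>e(-kx)\<close> exactly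
  when \<open>n = dk\<close>, and these terms add up to \<open>R \<B> \<integral>w\<close>. For \<open>n \<noteq> dk\<close>, integrating by parts \<open>j\<close> times gives
  \<open>O(R (rR/d)\<^sup>-\<^sup>j)\<close> with \<open>r = |n - dk|\<close>. Sorting these dyadically by \<open>V \<le> rR/d < 2V\<close> produces the sums of the
  hypothesis, weighted by \<open>V\<^sup>-\<^sup>j\<close>, so their total is \<open>o(R \<B>)\<close>. Since the test function has squared
  \<open>L\<^sup>2\<close> norm \<open>O(RN)\<close>, the Cauchy-Schwarz inequality gives the bound.
\<close>

section \<open>The exponential \<open>ee\<close>\<close>

lemma ee_eq_cis: "ee x = cis (2 * pi * x)"
  by (simp add: ee_def cis_conv_exp mult_ac)

lemma norm_ee [simp]: "cmod (ee x) = 1"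
  by (simp add: ee_eq_cis)

lemma ee_add: "ee (x + y) = ee x * ee y"
  by (simp add: ee_eq_cis cis_mult algebra_simps)

lemma ee_of_int [simp]: "ee (of_int k) = 1"
  by (simp add: ee_eq_cis complex_eq_iff sin_int_2pin cos_int_2pin)

lemma cnj_ee: "cnj (ee x) = ee (- x)"
  by (simp add: ee_eq_cis cis_cnj)

lemma has_vector_derivative_ee:
  "((\<lambda>t. ee (c * t)) has_vector_derivative (2 * of_real pi * \<i> * of_real c) * ee (c * t)) (at t within S)"
proof -
  have "((\<lambda>z. exp (2 * of_real pi * \<i> * of_real c * z)) has_field_derivative
      (2 * of_real pi * \<i> * of_real c) * exp (2 * of_real pi * \<i> * of_real c * of_real t)) (at (of_real t))"
    by (auto intro!: derivative_eq_intros)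
  from has_vector_derivative_real_field[OF this, of S] show ?thesis
    by (simp add: ee_def mult_ac)
qed

lemma continuous_on_ee [continuous_intros]:
  "continuous_on S g \<Longrightarrow> continuous_on S (\<lambda>x. ee (g x))"
  unfolding ee_def by (intro continuous_intros)

section \<open>Derivatives of the cutoff and decay of oscillatory integrals\<close>

lemma smooth_has_real_derivative:
  assumes "smooth \<phi>"
  shows "((deriv ^^ m) \<phi> has_real_derivative (deriv ^^ Suc m) \<phi> x) (at x)"
  using assms unfolding smooth_def by (simp add: DERIV_deriv_iff_real_differentiable)

lemma smooth_continuous_on:
  assumes "smooth \<phi>"
  shows "continuous_on S ((deriv ^^ m) \<phi>)"
  by (meson DERIV_isCont assms continuous_at_imp_continuous_on smooth_has_real_derivative)

lemma higher_deriv_eventually_const: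
  fixes \<phi> :: "real \<Rightarrow> real"
  assumes "open U" "\<And>x. x \<in> U \<Longrightarrow> \<phi> x = c" "x \<in> U"
  shows "(deriv ^^ Suc m) \<phi> x = 0"
  using assms(3)
proof (induction m arbitrary: x)
  case 0
  have "(\<phi> has_real_derivative 0) (at x)"
    by (rule has_field_derivative_transform_within_open[OF DERIV_const[of c]])
      (use assms 0 in auto)
  then show ?case by (simp add: DERIV_imp_deriv)
next
  case (Suc m)
  have "((deriv ^^ Suc m) \<phi> has_real_derivative 0) (at x)"
    by (rule has_field_derivative_transform_within_open[OF DERIV_const[of 0] assms(1) Suc.prems])
      (use Suc.IH in simp)
  then show ?case by (simp add: DERIV_imp_deriv)
qed

text \<open>The point is a bound independent of \<open>s\<close>. Where \<open>s * t\<close> lies in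
  \<open>{1..2}\<close>, the condition \<open>t \<ge> 1\<close> forces \<open>s \<le> 2\<close>, so
  the factor \<open>s ^ m\<close> is harmless; elsewhere \<open>\<phi>\<close> is locally
  constant.\<close>

lemma dilated_deriv_bounded:
  assumes "smooth \<phi>" and "\<And>x. x < 1 \<Longrightarrow> \<phi> x = 0" and "\<And>x. x > 2 \<Longrightarrow> \<phi> x = 1"
  shows "\<exists>C\<ge>0. \<forall>s>0. \<forall>t\<in>{1..2}. \<bar>s ^ m * (deriv ^^ m) \<phi> (s * t)\<bar> \<le> C"
proof -
  have "bounded ((deriv ^^ m) \<phi> ` {1..2})"
    by (intro compact_imp_bounded compact_continuous_image smooth_continuous_on assms) auto
  then obtain C0 where C0: "\<And>x. x \<in> {1..2} \<Longrightarrow> \<bar>(deriv ^^ m) \<phi> x\<bar> \<le> C0"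
    unfolding bounded_iff by force
  have C0_nonneg: "0 \<le> C0" using C0[of 1] by simp
  \<comment> \<open>The 1 in the maximum serves \<open>m = 0\<close>, since \<open>\<phi>\<close>
    itself equals 1 beyond 2; the proper derivatives vanish outside \<open>{1..2}\<close>.\<close>
  have "\<bar>s ^ m * (deriv ^^ m) \<phi> (s * t)\<bar> \<le> max 1 (2 ^ m * C0)" if "s > 0" "t \<in> {1..2}" for s t
  proof (cases "s * t \<in> {1..2}")
    case True
    have "s * 1 \<le> s * t" using that by (intro mult_left_mono) auto
    then have "s \<le> 2" using True by simp
    then have "\<bar>s ^ m * (deriv ^^ m) \<phi> (s * t)\<bar> \<le> 2 ^ m * C0"
      unfolding abs_mult using that C0[OF True]
      by (intro mult_mono) (auto simp: power_mono)
    then show ?thesis by simp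
  next
    case False
    then consider "s * t < 1" | "s * t > 2" by force
    then show ?thesis
    proof cases
      case 1
      then show ?thesis using assms higher_deriv_eventually_const[of "{..<1}" \<phi> 0 "s * t"]
        by (cases m) auto
    next
      case 2
      then show ?thesis using assms higher_deriv_eventually_const[of "{2<..}" \<phi> 1 "s * t"]
        by (cases m) auto
    qed
  qed
  then show ?thesis by (intro exI[of _ "max 1 (2 ^ m * C0)"]) auto
qed

text \<open>An integration by parts that differentiates the polynomial costs it one factor of the
  bump, so an initial power \<open>j\<close> leaves room for \<open>j\<close> integrations with
  vanishing boundary terms.\<close>

lemma power_dvd_pderiv:
  fixes p q :: "real poly"
  assumes "q ^ Suc j dvd p"
  shows "q ^ j dvd pderiv p"
proof -
  obtain s where s: "p = q ^ Suc j * s" using assms by (auto elim: dvdE)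
  show ?thesis unfolding s pderiv_mult pderiv_power_Suc by (intro dvd_add dvd_mult dvd_mult2 dvd_smult) auto
qed

text \<open>
  Stated for all derivatives of \<open>\<phi>\<close> and all multiples of the bump polynomial so that the class of integrands
  is closed under integration by parts. Uniformity in the dilation \<open>s\<close> is what makes the bound usable for all \<open>d\<close>.
\<close>
lemma oscillatory_integral_bound:
  fixes p :: "real poly"
  assumes "smooth \<phi>" and "\<And>x. x < 1 \<Longrightarrow> \<phi> x = 0" and "\<And>x. x > 2 \<Longrightarrow> \<phi> x = 1"
    and "([:-1, 1:] * [:2, -1:]) ^ j dvd p"
  shows "\<exists>C\<ge>0. \<forall>s>0. \<forall>\<theta>. \<theta> \<noteq> 0 \<longrightarrow>
    cmod (integral {1..2} (\<lambda>t. of_real (s ^ m * (deriv ^^ m) \<phi> (s * t) * poly p t) * ee (\<theta> * t)))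
      \<le> C * (1 / \<bar>\<theta>\<bar> ^ j)"
  using assms(4)
proof (induction j arbitrary: m p)
  case 0
  obtain C1 where C1: "C1 \<ge> 0" "\<And>s t. s > 0 \<Longrightarrow> t \<in> {1..2} \<Longrightarrow> \<bar>s ^ m * (deriv ^^ m) \<phi> (s * t)\<bar> \<le> C1"
    using dilated_deriv_bounded[OF assms(1-3), where m = m] by blast
  have "bounded (poly p ` {1..2})"
    by (intro compact_imp_bounded compact_continuous_image continuous_intros) auto
  then obtain C2 where C2: "\<And>x. x \<in> {1..2} \<Longrightarrow> \<bar>poly p x\<bar> \<le> C2"
    unfolding bounded_iff by force
  have C2_nonneg: "0 \<le> C2" using C2[of 1] by simp
  have "cmod (integral {1..2} (\<lambda>t. of_real (s ^ m * (deriv ^^ m) \<phi> (s * t) * poly p t) * ee (\<theta> * t)))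
      \<le> C1 * C2 * (2 - 1)" if "s > 0" for s \<theta>
  proof (rule integral_bound)
    show "continuous_on {1..2} (\<lambda>t. complex_of_real (s ^ m * (deriv ^^ m) \<phi> (s * t) * poly p t) * ee (\<theta> * t))"
      by (intro continuous_intros continuous_on_compose2[OF smooth_continuous_on[OF assms(1), of UNIV]]) auto
    fix t :: real assume "t \<in> {1..2}"
    then show "cmod (complex_of_real (s ^ m * (deriv ^^ m) \<phi> (s * t) * poly p t) * ee (\<theta> * t)) \<le> C1 * C2"
      unfolding norm_mult norm_of_real norm_ee mult_1_right abs_mult[of "_ * _" "poly p t"]
      using C1 C2 that C2_nonneg by (intro mult_mono) auto
  qed auto
  then show ?case using C1 C2_nonneg by (intro exI[of _ "C1 * C2"]) auto
next
  case (Suc j)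
  let ?I = "\<lambda>m p s \<theta>. integral {1..2} (\<lambda>t. complex_of_real (s ^ m * (deriv ^^ m) \<phi> (s * t) * poly p t) * ee (\<theta> * t))"
  have cont: "continuous_on {1..2} (\<lambda>t. complex_of_real (s ^ m * (deriv ^^ m) \<phi> (s * t) * poly p t) * ee (\<theta> * t))"
    for m p s \<theta>
    by (intro continuous_intros continuous_on_compose2[OF smooth_continuous_on[OF assms(1), of UNIV]]) auto
  \<comment> \<open>The derivative falls either on the cutoff or on the polynomial. In the first
    case the chain rule turns \<open>s ^ m\<close> into \<open>s ^ Suc m\<close>; in both cases at
    least \<open>j\<close> factors of the bump remain, so the induction hypothesis applies.\<close>
  have "([:-1, 1:] * [:2, -1:]) ^ j dvd p"
    using Suc.prems by (rule power_le_dvd) simp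
  from Suc.IH[OF this, of "Suc m"] obtain C1 where
    C1: "C1 \<ge> 0" "\<And>s \<theta>. s > 0 \<Longrightarrow> \<theta> \<noteq> 0 \<Longrightarrow> cmod (?I (Suc m) p s \<theta>) \<le> C1 * (1 / \<bar>\<theta>\<bar> ^ j)"
    by blast
  from Suc.IH[OF power_dvd_pderiv[OF Suc.prems], of m] obtain C2 where
    C2: "C2 \<ge> 0" "\<And>s \<theta>. s > 0 \<Longrightarrow> \<theta> \<noteq> 0 \<Longrightarrow> cmod (?I m (pderiv p) s \<theta>) \<le> C2 * (1 / \<bar>\<theta>\<bar> ^ j)"
    by blast
  \<comment> \<open>One factor of the bump already removes the boundary terms at 1 and 2.\<close>
  have "[:-1, 1:] * [:2, -1:] dvd p"
    using power_le_dvd[OF Suc.prems, of 1] by simp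
  then have zero: "poly p 1 = 0" "poly p 2 = 0" by (auto elim!: dvdE)
  have "cmod (?I m p s \<theta>) \<le> (C1 + C2) * (1 / \<bar>\<theta>\<bar> ^ Suc j)" if s: "s > 0" and \<theta>: "\<theta> \<noteq> 0" for s \<theta>
  proof -
    let ?u = "\<lambda>m p t. complex_of_real (s ^ m * (deriv ^^ m) \<phi> (s * t) * poly p t) * ee (\<theta> * t)"
    let ?c = "2 * of_real pi * \<i> * complex_of_real \<theta>"
    have "((\<lambda>t. ?u (Suc m) p t + ?u m (pderiv p) t + ?c * ?u m p t) has_integral (?u m p 2 - ?u m p 1)) {1..2}"
    proof (rule fundamental_theorem_of_calculus)
      fix t :: real
      have "((\<lambda>t. s ^ m * (deriv ^^ m) \<phi> (s * t) * poly p t) has_real_derivative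
          s ^ Suc m * (deriv ^^ Suc m) \<phi> (s * t) * poly p t + s ^ m * (deriv ^^ m) \<phi> (s * t) * poly (pderiv p) t) (at t within {1..2})"
        by (rule derivative_eq_intros DERIV_chain2[OF smooth_has_real_derivative[OF assms(1)]] poly_DERIV refl
            | (simp; fail))+
      then have "((\<lambda>t. complex_of_real (s ^ m * (deriv ^^ m) \<phi> (s * t) * poly p t)) has_vector_derivative
          complex_of_real (s ^ Suc m * (deriv ^^ Suc m) \<phi> (s * t) * poly p t + s ^ m * (deriv ^^ m) \<phi> (s * t) * poly (pderiv p) t)) (at t within {1..2})"
        by (intro has_vector_derivative_of_real) (simp add: has_real_derivative_iff_has_vector_derivative)
      from has_vector_derivative_mult[OF this has_vector_derivative_ee[of \<theta>]]
      show "(?u m p has_vector_derivative ?u (Suc m) p t + ?u m (pderiv p) t + ?c * ?u m p t) (at t within {1..2})"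
        by (simp add: algebra_simps)
    qed simp
    moreover have "((\<lambda>t. ?u (Suc m) p t + ?u m (pderiv p) t + ?c * ?u m p t) has_integral
        ?I (Suc m) p s \<theta> + ?I m (pderiv p) s \<theta> + ?c * ?I m p s \<theta>) {1..2}"
      by (intro has_integral_add has_integral_mult_right integrable_integral integrable_continuous_real cont)
    ultimately have zero_sum: "?I (Suc m) p s \<theta> + ?I m (pderiv p) s \<theta> + ?c * ?I m p s \<theta> = ?u m p 2 - ?u m p 1"
      by (blast intro: has_integral_unique)
    have c: "cmod ?c = 2 * pi * \<bar>\<theta>\<bar>" by (simp add: norm_mult)
    from zero_sum have "?c * ?I m p s \<theta> = - (?I (Suc m) p s \<theta> + ?I m (pderiv p) s \<theta>)"
      unfolding zero eq_neg_iff_add_eq_0 of_real_0 mult_zero_left mult_zero_right diff_self by (simp only: ac_simps)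
    then have "cmod (?c * ?I m p s \<theta>) \<le> cmod (?I (Suc m) p s \<theta>) + cmod (?I m (pderiv p) s \<theta>)"
      by (simp only: norm_minus_cancel norm_triangle_ineq)
    then have "2 * pi * \<bar>\<theta>\<bar> * cmod (?I m p s \<theta>) \<le> (C1 + C2) * (1 / \<bar>\<theta>\<bar> ^ j)"
      using C1(2)[OF s \<theta>] C2(2)[OF s \<theta>] norm_mult[of ?c "?I m p s \<theta>", unfolded c] unfolding distrib_right by linarith
    \<comment> \<open>Discarding the factor \<open>2 * pi \<ge> 1\<close> keeps the constant as
      \<open>C1 + C2\<close>.\<close>
    moreover have "1 * (\<bar>\<theta>\<bar> * cmod (?I m p s \<theta>)) \<le> 2 * pi * (\<bar>\<theta>\<bar> * cmod (?I m p s \<theta>))"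
      using pi_ge_two by (intro mult_right_mono) auto
    ultimately have "\<bar>\<theta>\<bar> * cmod (?I m p s \<theta>) \<le> (C1 + C2) * (1 / \<bar>\<theta>\<bar> ^ j)" by linarith
    moreover have "x \<le> c * (1 / y ^ Suc j)" if "y > 0" "y * x \<le> c * (1 / y ^ j)" for x y c :: real
      using that by (simp add: field_simps)
    ultimately show ?thesis using \<theta> by simp
  qed
  then show ?case using C1(1) C2(1) by (intro exI[of _ "C1 + C2"]) auto
qed

section \<open>Mean square of the exponential sum over \<open>k\<close>\<close>

text \<open>Orthogonality of characters: integer endpoints span whole periods, so for
  \<open>c \<noteq> 0\<close> the primitive takes the same value at both ends.\<close>

lemma has_integral_ee_periods:
  fixes c m :: int and M :: nat
  shows "((\<lambda>x. ee (of_int c * x)) has_integral (if c = 0 then of_nat M else 0)) {of_int m..of_int m + of_nat M}"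
proof (cases "c = 0")
  case True
  then show ?thesis
    using has_integral_const_real[of "1 :: complex" "of_int m" "of_int m + of_nat M"]
    by (simp add: ee_eq_cis scaleR_conv_of_real)
next
  case False
  let ?k = "2 * of_real pi * \<i> * complex_of_real (of_int c)"
  have k: "?k \<noteq> 0" using False by simp
  have "((\<lambda>x. ee (of_int c * x)) has_integral
      ee (of_int c * (of_int m + of_nat M)) / ?k - ee (of_int c * of_int m) / ?k) {of_int m..of_int m + of_nat M}"
  proof (rule fundamental_theorem_of_calculus)
    fix x :: real
    show "((\<lambda>x. ee (of_int c * x) / ?k) has_vector_derivative ee (of_int c * x))
        (at x within {of_int m..of_int m + of_nat M})"
      using has_vector_derivative_divide[OF has_vector_derivative_ee[of "of_int c" x "{of_int m..of_int m + of_nat M}"], of ?k] k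
      by simp
  qed simp
  moreover have "ee (of_int c * (of_int m + of_nat M)) = 1" "ee (of_int c * of_int m) = 1"
    using ee_of_int[of "c * (m + int M)"] ee_of_int[of "c * m"] by simp_all
  ultimately show ?thesis using False by simp
qed

text \<open>Enlarging the range to one with integer endpoints makes orthogonality exact: only the
  \<open>N\<close> pairs \<open>k = l\<close> survive, each contributing the length
  \<open>M\<close>.\<close>

lemma integral_dirichlet_kernel_le:
  fixes R :: real
  assumes "R \<ge> 1"
  shows "integral {R..2*R} (\<lambda>x. (cmod (\<Sum>k=1..N. ee (- (real k * x))))\<^sup>2) \<le> 3 * R * real N"
proof -
  define m where "m = \<lfloor>R\<rfloor>"
  \<comment> \<open>The summand 1 compensates for rounding \<open>R\<close> down in
    \<open>m\<close>, so that \<open>m + M \<ge> 2 * R\<close>; thanks to \<open>R \<ge> 1\<close>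
    still \<open>M \<le> 3 * R\<close>.\<close>
  define M where "M = nat \<lceil>R\<rceil> + 1"
  let ?D = "\<lambda>x. \<Sum>k=1..N. ee (- (real k * x))"
  let ?S = "{real_of_int m..real_of_int m + real M}"
  have expand: "complex_of_real ((cmod (?D x))\<^sup>2) = (\<Sum>k=1..N. \<Sum>l=1..N. ee (of_int (int l - int k) * x))" for x
    unfolding complex_norm_square cnj_sum sum_product cnj_ee
    by (intro sum.cong refl) (simp add: ee_add[symmetric] algebra_simps)
  have "((\<lambda>x. complex_of_real ((cmod (?D x))\<^sup>2)) has_integral
      (\<Sum>k=1..N. \<Sum>l=1..N. if int l - int k = 0 then of_nat M else 0)) ?S"
    unfolding expand by (intro has_integral_sum has_integral_ee_periods) auto
  also have "(\<Sum>k=1..N. \<Sum>l=1..N. if int l - int k = 0 then of_nat M else 0) = (of_nat (N * M) :: complex)"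
    by (simp add: sum.delta)
  finally have "((Re \<circ> (\<lambda>x. complex_of_real ((cmod (?D x))\<^sup>2))) has_integral Re (of_nat (N * M))) ?S"
    by (rule has_integral_linear[OF _ bounded_linear_Re])
  then have eq: "integral ?S (\<lambda>x. (cmod (?D x))\<^sup>2) = real (N * M)"
    by (simp add: o_def integral_unique)
  have "integral {R..2*R} (\<lambda>x. (cmod (?D x))\<^sup>2) \<le> integral ?S (\<lambda>x. (cmod (?D x))\<^sup>2)"
  proof (rule integral_subset_le)
    show "{R..2*R} \<subseteq> ?S" unfolding m_def M_def using assms by (auto; linarith)
  qed (auto intro!: integrable_continuous_real continuous_intros)
  also have "\<dots> \<le> real N * (3 * R)"
    unfolding eq of_nat_mult using assms by (intro mult_left_mono) (auto simp: M_def, linarith)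
  finally show ?thesis by (simp add: mult_ac)
qed

section \<open>Expansion of the pairing of \<open>Gsum\<close> with the test function\<close>

text \<open>The integral of one term of the pairing after the substitution \<open>x = R * t\<close>,
  to be taken at \<open>s = R / d\<close> and \<open>\<theta> = R * (n / d - k)\<close>. It is the
  case \<open>m = 0\<close> of \<open>oscillatory_integral_bound\<close>.\<close>

definition osc_integral :: "(real \<Rightarrow> real) \<Rightarrow> real poly \<Rightarrow> real \<Rightarrow> real \<Rightarrow> complex" where
  "osc_integral \<phi> p s \<theta> = integral {1..2} (\<lambda>t. of_real (\<phi> (s * t) * poly p t) * ee (\<theta> * t))"

text \<open>The added terms have \<open>x / d < 1\<close>, where the cutoff vanishes. A range of
  summation independent of \<open>x\<close> gives continuity of \<open>Gsum\<close> on
  \<open>{R..2*R}\<close> and lets sum and integral be exchanged.\<close>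

lemma Gsum_eq:
  assumes "\<And>x. x < 1 \<Longrightarrow> \<phi> x = 0" and "x \<le> 2 * R"
  shows "Gsum f \<phi> N a x = (\<Sum>d=1..nat \<lfloor>2 * R\<rfloor>. f d * Fsum \<phi> N a (x / real d))"
  unfolding Gsum_def
proof (rule sum.mono_neutral_left)
  show "{n. 1 \<le> n \<and> real n \<le> x} \<subseteq> {1..nat \<lfloor>2 * R\<rfloor>}" using assms(2) by (auto simp: le_nat_floor)
  show "\<forall>d\<in>{1..nat \<lfloor>2 * R\<rfloor>} - {n. 1 \<le> n \<and> real n \<le> x}. f d * Fsum \<phi> N a (x / real d) = 0"
  proof
    fix d assume "d \<in> {1..nat \<lfloor>2 * R\<rfloor>} - {n. 1 \<le> n \<and> real n \<le> x}"
    then have "x / real d < 1" by (auto simp: field_simps)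
    then show "f d * Fsum \<phi> N a (x / real d) = 0" using assms(1) by (simp add: Fsum_def)
  qed
qed simp

lemma continuous_on_Fsum_dilated:
  assumes "smooth \<phi>"
  shows "continuous_on S (\<lambda>x. Fsum \<phi> N a (x / real d))"
  unfolding Fsum_def divide_inverse
  by (intro continuous_intros continuous_on_compose2[OF smooth_continuous_on[OF assms, of UNIV 0, simplified]]) auto

lemma continuous_on_Gsum:
  assumes "smooth \<phi>" and "\<And>x. x < 1 \<Longrightarrow> \<phi> x = 0"
  shows "continuous_on {R..2*R} (Gsum f \<phi> N a)"
proof -
  have "continuous_on {R..2*R} (\<lambda>x. \<Sum>d=1..nat \<lfloor>2 * R\<rfloor>. f d * Fsum \<phi> N a (x / real d))"
    by (intro continuous_intros continuous_on_Fsum_dilated assms)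
  then show ?thesis
    by (rule continuous_on_eq) (use Gsum_eq[of \<phi> _ R f N a, OF assms(2)] in simp)
qed

lemma has_integral_osc:
  assumes "smooth \<phi>" and "R > 0"
  shows "((\<lambda>x. of_real (\<phi> (x / real d) * poly p (x / R)) * ee ((real n / real d - real k) * x)) has_integral
    of_real R * osc_integral \<phi> p (R / real d) (R * (real n / real d - real k))) {R..2*R}"
proof -
  let ?g = "\<lambda>x. complex_of_real (\<phi> (x / real d) * poly p (x / R)) * ee ((real n / real d - real k) * x)"
  have "?g integrable_on {R..2*R}"
    unfolding divide_inverse
    by (intro integrable_continuous_real continuous_intros
        continuous_on_compose2[OF smooth_continuous_on[OF assms(1), of UNIV 0, simplified]]) auto
  moreover have "(\<lambda>x. x / R) ` {R..2*R} = {1..2}"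
    using assms(2) image_divide_atLeastAtMost[of R R "2 * R"] by simp
  then have "osc_integral \<phi> p (R / real d) (R * (real n / real d - real k)) = (1 / R) *\<^sub>R integral {R..2*R} ?g"
    using integral_stretch_real[of R R "2 * R" ?g] assms(2)
    by (simp add: osc_integral_def mult_ac)
  then have "integral {R..2*R} ?g = of_real R * osc_integral \<phi> p (R / real d) (R * (real n / real d - real k))"
    using assms(2) by (simp add: scaleR_conv_of_real)
  ultimately show ?thesis unfolding has_integral_iff by blast
qed

lemma integral_Gsum_kernel:
  assumes "smooth \<phi>" and "\<And>x. x < 1 \<Longrightarrow> \<phi> x = 0" and "R > 0"
  shows "integral {R..2*R} (\<lambda>x. Gsum f \<phi> N a x * (of_real (poly p (x / R)) * (\<Sum>k=1..N. ee (- (real k * x))))) =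
    (\<Sum>d=1..nat \<lfloor>2 * R\<rfloor>. \<Sum>n=1..N. \<Sum>k=1..N. f d * a n *
       (of_real R * osc_integral \<phi> p (R / real d) (R * (real n / real d - real k))))"
proof (rule integral_unique)
  have "((\<lambda>x. \<Sum>d=1..nat \<lfloor>2 * R\<rfloor>. \<Sum>n=1..N. \<Sum>k=1..N. f d * a n *
        (of_real (\<phi> (x / real d) * poly p (x / R)) * ee ((real n / real d - real k) * x))) has_integral
      (\<Sum>d=1..nat \<lfloor>2 * R\<rfloor>. \<Sum>n=1..N. \<Sum>k=1..N. f d * a n *
       (of_real R * osc_integral \<phi> p (R / real d) (R * (real n / real d - real k))))) {R..2*R}"
    by (intro has_integral_sum has_integral_mult_right has_integral_osc assms) auto
  then show "((\<lambda>x. Gsum f \<phi> N a x * (of_real (poly p (x / R)) * (\<Sum>k=1..N. ee (- (real k * x))))) has_integral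
      (\<Sum>d=1..nat \<lfloor>2 * R\<rfloor>. \<Sum>n=1..N. \<Sum>k=1..N. f d * a n *
       (of_real R * osc_integral \<phi> p (R / real d) (R * (real n / real d - real k))))) {R..2*R}"
  proof (rule has_integral_eq[rotated])
    fix x assume "x \<in> {R..2*R}"
    then have G: "Gsum f \<phi> N a x = (\<Sum>d=1..nat \<lfloor>2 * R\<rfloor>. f d * Fsum \<phi> N a (x / real d))"
      using Gsum_eq[of \<phi> x R f N a, OF assms(2)] by simp
    have summand: "f d * Fsum \<phi> N a (x / real d) * (of_real (poly p (x / R)) * (\<Sum>k=1..N. ee (- (real k * x)))) =
       (\<Sum>n=1..N. \<Sum>k=1..N. f d * a n *
        (of_real (\<phi> (x / real d) * poly p (x / R)) * ee ((real n / real d - real k) * x)))" for d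
    proof -
      have "f d * Fsum \<phi> N a (x / real d) * (of_real (poly p (x / R)) * (\<Sum>k=1..N. ee (- (real k * x)))) =
        f d * of_real (\<phi> (x / real d) * poly p (x / R)) *
          ((\<Sum>n=1..N. a n * ee (real n * (x / real d))) * (\<Sum>k=1..N. ee (- (real k * x))))"
        by (simp add: Fsum_def)
      also have "\<dots> = (\<Sum>n=1..N. \<Sum>k=1..N. f d * a n *
        (of_real (\<phi> (x / real d) * poly p (x / R)) * (ee (real n * (x / real d)) * ee (- (real k * x)))))"
        unfolding sum_product unfolding sum_distrib_left by (intro sum.cong refl) (simp add: mult_ac)
      also have "\<dots> = (\<Sum>n=1..N. \<Sum>k=1..N. f d * a n *
        (of_real (\<phi> (x / real d) * poly p (x / R)) * ee ((real n / real d - real k) * x)))"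
        unfolding ee_add[symmetric] by (intro sum.cong refl) (simp add: left_diff_distrib)
      finally show ?thesis .
    qed
    show "(\<Sum>d=1..nat \<lfloor>2 * R\<rfloor>. \<Sum>n=1..N. \<Sum>k=1..N. f d * a n *
        (of_real (\<phi> (x / real d) * poly p (x / R)) * ee ((real n / real d - real k) * x))) =
       Gsum f \<phi> N a x * (of_real (poly p (x / R)) * (\<Sum>k=1..N. ee (- (real k * x))))"
      unfolding G sum_distrib_right[of _ _ "of_real _ * _"] summand ..
  qed
qed

section \<open>Off-diagonal terms, sorted into dyadic shells\<close>

lemma card_abs_diff_mult_le:
  fixes d n r :: nat
  assumes "d > 0"
  shows "card {k\<in>A. \<bar>int n - int d * int k\<bar> = int r} \<le> 2"
proof -
  \<comment> \<open>For every \<open>k\<close> that occurs the division is exact and the quotient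
    nonnegative, so \<open>div\<close> and \<open>nat\<close> lose nothing.\<close>
  have "{k\<in>A. \<bar>int n - int d * int k\<bar> = int r} \<subseteq> {nat ((int n + int r) div int d), nat ((int n - int r) div int d)}"
  proof
    fix k assume "k \<in> {k\<in>A. \<bar>int n - int d * int k\<bar> = int r}"
    then have "int n + int r = int d * int k \<or> int n - int r = int d * int k" by auto
    then show "k \<in> {nat ((int n + int r) div int d), nat ((int n - int r) div int d)}"
      using assms by auto
  qed
  then have "card {k\<in>A. \<bar>int n - int d * int k\<bar> = int r} \<le>
      card {nat ((int n + int r) div int d), nat ((int n - int r) div int d)}"
    by (rule card_mono[rotated]) simp
  also have "\<dots> \<le> 2" by (simp add: card_insert_le_m1)
  finally show ?thesis .
qed

text \<open>The least \<open>i\<close> with \<open>v < 2 ^ i\<close> works. Minimality gives the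
  lower bound unless \<open>i = 0\<close>, where the assumption \<open>1 / 2 \<le> v\<close> takes
  over.\<close>

lemma dyadic_index:
  fixes v :: real
  assumes "1 / 2 \<le> v" and "v < 2 ^ L"
  shows "\<exists>i\<le>L. 2 ^ i / 2 \<le> v \<and> v < 2 ^ i"
proof -
  define i where "i = (LEAST i. v < 2 ^ i)"
  have "v < 2 ^ i" unfolding i_def by (rule LeastI) (fact assms(2))
  moreover have "i \<le> L" unfolding i_def by (rule Least_le) (fact assms(2))
  moreover have "2 ^ i / 2 \<le> v"
  proof (cases i)
    case 0
    then show ?thesis using assms by simp
  next
    case (Suc i')
    then have "\<not> v < 2 ^ i'" unfolding i_def by (metis lessI not_less_Least)
    then show ?thesis using Suc by simp
  qed
  ultimately show ?thesis by blast
qed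

text \<open>With \<open>r = \<bar>n - d * k\<bar>\<close> the shell condition reads
  \<open>V \<le> R * r / d < 2 * V\<close>, which is the range of \<open>r\<close> in
  \<open>near_multiple_sum\<close>, and \<open>n\<close> is congruent to \<open>r\<close> or
  \<open>- r\<close> modulo \<open>d\<close>. The factor 2 counts the \<open>k\<close> that share a
  value of \<open>r\<close>.\<close>

lemma near_multiple_shell_le:
  fixes R V :: real and D N :: nat
  assumes R: "R > 0" and V: "V > 0" and D: "real D \<le> 2 * R"
  shows "(\<Sum>d=1..D. \<Sum>n=1..N. \<Sum>k\<in>{k\<in>{1..N}. d * k \<noteq> n \<and> \<bar>R * (real n / real d - real k)\<bar> \<in> {V..<2*V}}. cmod (a n))
    \<le> 2 * near_multiple_sum N a R V"
proof -
  let ?K = "\<lambda>d n. {k\<in>{1..N}. d * k \<noteq> n \<and> \<bar>R * (real n / real d - real k)\<bar> \<in> {V..<2*V}}"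
  let ?R = "\<lambda>d. {r::nat. real d * V / R \<le> real r \<and> real r < 2 * real d * V / R}"
  let ?D = "{d::nat. R / (2 * V) \<le> real d \<and> real d \<le> 3 * R}"
  let ?P = "\<lambda>d r n. [int n = int r] (mod int d) \<or> [int n = - int r] (mod int d)"
  have finR: "finite (?R d)" for d
  proof (rule finite_subset)
    show "?R d \<subseteq> {..nat \<lceil>2 * real d * V / R\<rceil>}" by (auto; linarith)
  qed simp
  have finD: "finite ?D"
  proof (rule finite_subset)
    show "?D \<subseteq> {..nat \<lceil>3 * R\<rceil>}" by (auto; linarith)
  qed simp
  have shell: "nat \<bar>int n - int d * int k\<bar> \<in> ?R d \<and> ?P d (nat \<bar>int n - int d * int k\<bar>) n \<and> R / (2 * V) \<le> real d"
    if "d \<ge> 1" "k \<in> ?K d n" for d n k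
  proof -
    define r where "r = nat \<bar>int n - int d * int k\<bar>"
    have "real r = \<bar>real n - real d * real k\<bar>" by (simp add: r_def)
    also have "\<dots> = real d * \<bar>real n / real d - real k\<bar>"
    proof -
      have "real n - real d * real k = real d * (real n / real d - real k)"
        using that(1) by (simp add: right_diff_distrib)
      then show ?thesis by (simp add: abs_mult)
    qed
    finally have v: "\<bar>R * (real n / real d - real k)\<bar> = R * real r / real d"
      using that(1) R by (simp add: abs_mult)
    \<comment> \<open>Off the diagonal \<open>r\<close> is a nonzero integer. Together with
      \<open>r < 2 * d * V / R\<close> this yields the lower bound on \<open>d\<close> in
      \<open>near_multiple_sum\<close>.\<close>
    have r1: "1 \<le> real r" using that by (auto simp: r_def simp flip: of_nat_mult)
    have "V \<le> R * real r / real d" "R * real r / real d < 2 * V" using that(2) unfolding v[symmetric] by auto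
    then have rr: "real d * V / R \<le> real r" "real r < 2 * real d * V / R"
      using R that(1) by (auto simp: field_simps)
    then have "1 < 2 * real d * V / R" using r1 by linarith
    then have "R / (2 * V) \<le> real d" using R V by (simp add: field_simps)
    moreover have "int d dvd int n - int r \<or> int d dvd int n + int r" unfolding r_def by (auto simp: abs_if)
    then have "?P d r n" by (simp add: cong_iff_dvd_diff)
    ultimately show ?thesis using rr by (simp add: r_def)
  qed
  \<comment> \<open>For given \<open>d\<close> and \<open>n\<close>, each \<open>r\<close> comes from at most two \<open>k\<close>, namely \<open>(n \<plusminus> r)/d\<close>.\<close>
  have card_K: "real (card (?K d n)) \<le> (\<Sum>r\<in>{r\<in>?R d. ?P d r n}. 2)" if "d \<ge> 1" for d n
  proof -
    have "card (?K d n) \<le> card (\<Union>r\<in>{r\<in>?R d. ?P d r n}. {k\<in>{1..N}. \<bar>int n - int d * int k\<bar> = int r})"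
    proof (rule card_mono)
      show "?K d n \<subseteq> (\<Union>r\<in>{r\<in>?R d. ?P d r n}. {k\<in>{1..N}. \<bar>int n - int d * int k\<bar> = int r})"
      proof
        fix k assume k: "k \<in> ?K d n"
        define r where "r = nat \<bar>int n - int d * int k\<bar>"
        have "r \<in> {r\<in>?R d. ?P d r n}" using shell[OF that k] unfolding r_def by blast
        moreover have "k \<in> {k\<in>{1..N}. \<bar>int n - int d * int k\<bar> = int r}"
          using k by (simp add: r_def)
        ultimately show "k \<in> (\<Union>r\<in>{r\<in>?R d. ?P d r n}. {k\<in>{1..N}. \<bar>int n - int d * int k\<bar> = int r})"
          by (rule UN_I)
      qed
    qed (auto intro: finite_subset[where B = "{1..N}"])
    also have "\<dots> \<le> (\<Sum>r\<in>{r\<in>?R d. ?P d r n}. card {k\<in>{1..N}. \<bar>int n - int d * int k\<bar> = int r})"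
      by (rule card_UN_le) (rule finite_subset[OF _ finR[of d]], blast)
    also have "\<dots> \<le> (\<Sum>r\<in>{r\<in>?R d. ?P d r n}. 2)"
      by (rule sum_mono, rule card_abs_diff_mult_le) (use that in simp)
    finally have "real (card (?K d n)) \<le> real (\<Sum>r\<in>{r\<in>?R d. ?P d r n}. 2)" by (rule of_nat_mono)
    then show ?thesis by simp
  qed
  \<comment> \<open>Values of \<open>d\<close> outside the range of \<open>near_multiple_sum\<close>
    have empty shells.\<close>
  have "(\<Sum>d=1..D. \<Sum>n=1..N. \<Sum>k\<in>?K d n. cmod (a n)) = (\<Sum>d\<in>?D \<inter> {1..D}. \<Sum>n=1..N. \<Sum>k\<in>?K d n. cmod (a n))"
  proof (rule sum.mono_neutral_right)
    show "\<forall>d\<in>{1..D} - ?D \<inter> {1..D}. (\<Sum>n=1..N. \<Sum>k\<in>?K d n. cmod (a n)) = 0"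
    proof
      fix d assume d: "d \<in> {1..D} - ?D \<inter> {1..D}"
      have "?K d n = {}" for n
      proof (rule ccontr)
        assume "?K d n \<noteq> {}"
        then obtain k where "k \<in> ?K d n" by blast
        then have "R / (2 * V) \<le> real d" using shell[of d k n] d by simp
        moreover have "real d \<le> 3 * R" using d D R by (auto dest!: of_nat_mono[where ?'a = real])
        ultimately show False using d by auto
      qed
      then show "(\<Sum>n=1..N. \<Sum>k\<in>?K d n. cmod (a n)) = 0" by (simp only: sum.empty sum.neutral_const)
    qed
  qed auto
  also have "\<dots> \<le> (\<Sum>d\<in>?D \<inter> {1..D}. 2 * (\<Sum>r\<in>?R d. \<Sum>n\<in>{n\<in>{1..N}. ?P d r n}. cmod (a n)))"
  proof (rule sum_mono)
    fix d assume d: "d \<in> ?D \<inter> {1..D}"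
    have "(\<Sum>n=1..N. \<Sum>k\<in>?K d n. cmod (a n)) = (\<Sum>n=1..N. real (card (?K d n)) * cmod (a n))"
      by simp
    also have "\<dots> \<le> (\<Sum>n=1..N. (\<Sum>r\<in>{r\<in>?R d. ?P d r n}. 2) * cmod (a n))"
      using d by (intro sum_mono mult_right_mono card_K) auto
    also have "\<dots> = 2 * (\<Sum>n=1..N. \<Sum>r\<in>{r\<in>?R d. ?P d r n}. cmod (a n))"
      by (simp add: sum_distrib_left mult_ac)
    also have "(\<Sum>n=1..N. \<Sum>r\<in>{r\<in>?R d. ?P d r n}. cmod (a n)) = (\<Sum>r\<in>?R d. \<Sum>n\<in>{n\<in>{1..N}. ?P d r n}. cmod (a n))"
      by (rule sum.swap_restrict) (use finR in auto)
    finally show "(\<Sum>n=1..N. \<Sum>k\<in>?K d n. cmod (a n)) \<le> 2 * (\<Sum>r\<in>?R d. \<Sum>n\<in>{n\<in>{1..N}. ?P d r n}. cmod (a n))" .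
  qed
  also have "\<dots> \<le> (\<Sum>d\<in>?D. 2 * (\<Sum>r\<in>?R d. \<Sum>n\<in>{n\<in>{1..N}. ?P d r n}. cmod (a n)))"
    by (rule sum_mono2[OF finD]) (auto intro!: sum_nonneg)
  finally show ?thesis by (simp add: near_multiple_sum_def sum_distrib_left)
qed


text \<open>Off the diagonal \<open>\<bar>n - d * k\<bar> \<ge> 1\<close> and
  \<open>d \<le> 2 * R\<close>, so the rescaled frequency is at least \<open>1 / 2\<close>. The
  shells may therefore start at \<open>V = 1 / 2\<close>, inside the range \<open>V > 1/6\<close>
  where \<open>near_multiple_sum\<close> is controlled.\<close>

lemma off_diagonal_dyadic_le:
  fixes R :: real and D N j :: nat
  assumes R: "R > 0" and D: "real D \<le> 2 * R"
  shows "\<exists>L. (\<Sum>d=1..D. \<Sum>n=1..N. \<Sum>k\<in>{k\<in>{1..N}. d * k \<noteq> n}. cmod (a n) * (1 / \<bar>R * (real n / real d - real k)\<bar> ^ j))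
    \<le> (\<Sum>i\<le>L. 1 / (2 ^ i / 2) ^ j * (2 * near_multiple_sum N a R (2 ^ i / 2)))"
proof -
  \<comment> \<open>Frequencies never exceed \<open>R * N\<close>, so finitely many shells cover
    them. The size of \<open>L\<close> is immaterial, since the shell bounds will be summed
    geometrically.\<close>
  obtain L where L: "R * real N < 2 ^ L" using real_arch_pow[of 2 "R * real N"] by auto
  let ?v = "\<lambda>d n k. \<bar>R * (real n / real d - real k)\<bar>"
  let ?P = "\<lambda>i d n k. ?v d n k \<in> {2 ^ i / 2..<2 * (2 ^ i / 2)}"
  have "(\<Sum>d=1..D. \<Sum>n=1..N. \<Sum>k\<in>{k\<in>{1..N}. d * k \<noteq> n}. cmod (a n) * (1 / ?v d n k ^ j)) \<le>
      (\<Sum>d=1..D. \<Sum>n=1..N. \<Sum>k\<in>{k\<in>{1..N}. d * k \<noteq> n}. \<Sum>i\<le>L. if ?P i d n k then 1 / (2 ^ i / 2) ^ j * cmod (a n) else 0)"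
  proof (intro sum_mono)
    fix d n k assume dnk: "d \<in> {1..D}" "n \<in> {1..N}" "k \<in> {k\<in>{1..N}. d * k \<noteq> n}"
    have d: "0 < real d" "real d \<le> 2 * R" using dnk D by auto
    have "real n / real d - real k = (real n - real d * real k) / real d"
      using d by (simp add: diff_divide_distrib)
    then have v: "?v d n k = R * \<bar>real n - real d * real k\<bar> / real d"
      using R d by (simp add: abs_mult)
    have "int n - int d * int k \<noteq> 0" using dnk by (simp flip: of_nat_mult)
    then have "1 \<le> \<bar>int n - int d * int k\<bar>" by linarith
    then have "real_of_int 1 \<le> real_of_int \<bar>int n - int d * int k\<bar>" by (simp only: of_int_le_iff)
    then have "R * 1 \<le> R * \<bar>real n - real d * real k\<bar>" using R by simp
    then have "real d \<le> 2 * (R * \<bar>real n - real d * real k\<bar>)" using d by linarith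
    then have lower: "1 / 2 \<le> ?v d n k" unfolding v using d by (simp add: field_simps)
    have "0 < real n / real d" using dnk d by simp
    moreover have "real n / real d \<le> real n / 1"
      using dnk by (intro divide_left_mono) auto
    ultimately have "\<bar>real n / real d - real k\<bar> \<le> real N" using dnk by (auto simp: abs_if)
    then have "?v d n k \<le> R * real N" using R by (simp add: abs_mult)
    then have "?v d n k < 2 ^ L" using L by linarith
    from dyadic_index[OF lower this] obtain i where i: "i \<le> L" "2 ^ i / 2 \<le> ?v d n k" "?v d n k < 2 ^ i" by blast
    have "1 / ?v d n k ^ j \<le> 1 / (2 ^ i / 2) ^ j"
      using i(2) by (intro frac_le power_mono) auto
    then have "cmod (a n) * (1 / ?v d n k ^ j) \<le> (if ?P i d n k then 1 / (2 ^ i / 2) ^ j * cmod (a n) else 0)"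
      using i mult_left_mono[of "1 / ?v d n k ^ j" "1 / (2 ^ i / 2) ^ j" "cmod (a n)"] by (simp add: mult.commute)
    also have "\<dots> \<le> (\<Sum>i\<le>L. if ?P i d n k then 1 / (2 ^ i / 2) ^ j * cmod (a n) else 0)"
      by (rule member_le_sum) (use i(1) in auto)
    finally show "cmod (a n) * (1 / ?v d n k ^ j) \<le> (\<Sum>i\<le>L. if ?P i d n k then 1 / (2 ^ i / 2) ^ j * cmod (a n) else 0)" .
  qed
  also have "\<dots> = (\<Sum>d=1..D. \<Sum>n=1..N. \<Sum>i\<le>L. \<Sum>k\<in>{k\<in>{1..N}. d * k \<noteq> n}. if ?P i d n k then 1 / (2 ^ i / 2) ^ j * cmod (a n) else 0)"
    by (intro sum.cong refl sum.swap)
  also have "\<dots> = (\<Sum>d=1..D. \<Sum>i\<le>L. \<Sum>n=1..N. \<Sum>k\<in>{k\<in>{1..N}. d * k \<noteq> n}. if ?P i d n k then 1 / (2 ^ i / 2) ^ j * cmod (a n) else 0)"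
    by (intro sum.cong refl sum.swap)
  also have "\<dots> = (\<Sum>i\<le>L. \<Sum>d=1..D. \<Sum>n=1..N. \<Sum>k\<in>{k\<in>{1..N}. d * k \<noteq> n}. if ?P i d n k then 1 / (2 ^ i / 2) ^ j * cmod (a n) else 0)"
    by (rule sum.swap)
  also have "\<dots> = (\<Sum>i\<le>L. 1 / (2 ^ i / 2) ^ j * (\<Sum>d=1..D. \<Sum>n=1..N. \<Sum>k\<in>{k\<in>{1..N}. d * k \<noteq> n \<and> ?P i d n k}. cmod (a n)))"
  proof (rule sum.cong[OF refl])
    fix i
    have restrict: "(\<Sum>k\<in>{k\<in>{1..N}. d * k \<noteq> n}. if ?P i d n k then 1 / (2 ^ i / 2) ^ j * cmod (a n) else 0) =
        (\<Sum>k\<in>{k\<in>{1..N}. d * k \<noteq> n \<and> ?P i d n k}. 1 / (2 ^ i / 2) ^ j * cmod (a n))" for d n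
    proof -
      have eq: "{k\<in>{1..N}. d * k \<noteq> n \<and> ?P i d n k} = {k \<in> {k\<in>{1..N}. d * k \<noteq> n}. ?P i d n k}" by blast
      show ?thesis unfolding eq by (rule sum.inter_filter[symmetric]) simp
    qed
    show "(\<Sum>d=1..D. \<Sum>n=1..N. \<Sum>k\<in>{k\<in>{1..N}. d * k \<noteq> n}. if ?P i d n k then 1 / (2 ^ i / 2) ^ j * cmod (a n) else 0) =
      1 / (2 ^ i / 2) ^ j * (\<Sum>d=1..D. \<Sum>n=1..N. \<Sum>k\<in>{k\<in>{1..N}. d * k \<noteq> n \<and> ?P i d n k}. cmod (a n))"
      unfolding restrict sum_distrib_left ..
  qed
  also have "\<dots> \<le> (\<Sum>i\<le>L. 1 / (2 ^ i / 2) ^ j * (2 * near_multiple_sum N a R (2 ^ i / 2)))"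
    by (intro sum_mono mult_left_mono near_multiple_shell_le assms) auto
  finally show ?thesis by blast
qed

lemma sum_inverse_two_powers_le: "(\<Sum>i\<le>L. 1 / (2::real) ^ i) \<le> 2"
proof -
  have "(\<Sum>i\<le>L. 1 / (2::real) ^ i) = 2 - 1 / 2 ^ L" by (induction L) (auto simp: field_simps)
  then show ?thesis by simp
qed

text \<open>Up to the factor \<open>6 ^ j\<close>, the weight of a shell times the assumed bound is
  \<open>(6 * V) powr (K - j)\<close>. By \<open>j \<ge> K + 1\<close> this is at most
  \<open>1 / (6 * V)\<close>, which decays geometrically along the shells.\<close>

lemma off_diagonal_le:
  fixes R K \<epsilon> b :: real and D N j :: nat
  assumes R: "R > 0" and D: "real D \<le> 2 * R" and j: "K + 1 \<le> real j"
    and "\<epsilon> \<ge> 0" "b \<ge> 0"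
    and V: "\<And>V. V > 1/6 \<Longrightarrow> near_multiple_sum N a R V \<le> \<epsilon> * ((6 * V) powr K * b)"
  shows "(\<Sum>d=1..D. \<Sum>n=1..N. \<Sum>k\<in>{k\<in>{1..N}. d * k \<noteq> n}. cmod (a n) * (1 / \<bar>R * (real n / real d - real k)\<bar> ^ j))
    \<le> 2 * 6 ^ j * \<epsilon> * b"
proof -
  obtain L where "(\<Sum>d=1..D. \<Sum>n=1..N. \<Sum>k\<in>{k\<in>{1..N}. d * k \<noteq> n}. cmod (a n) * (1 / \<bar>R * (real n / real d - real k)\<bar> ^ j))
    \<le> (\<Sum>i\<le>L. 1 / (2 ^ i / 2) ^ j * (2 * near_multiple_sum N a R (2 ^ i / 2)))"
    using off_diagonal_dyadic_le[OF R D] by blast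
  also have "\<dots> \<le> (\<Sum>i\<le>L. 6 ^ j * \<epsilon> * b * (1 / 2 ^ i))"
  proof (rule sum_mono)
    fix i :: nat
    define V where "V = (2 ^ i / 2 :: real)"
    have V1: "V \<ge> 1 / 2" by (simp add: V_def)
    have "(6 * V) powr K / (6 * V) ^ j = (6 * V) powr (K - real j)"
      using V1 by (simp add: powr_diff powr_realpow)
    also have "\<dots> \<le> (6 * V) powr (-1)"
      using V1 j by (intro powr_mono) auto
    also have "\<dots> = 1 / (6 * V)" using V1 by (simp add: powr_minus_divide)
    \<comment> \<open>Here \<open>6 * V = 3 * 2 ^ i\<close>. The factor \<open>1 / 2\<close> is kept
      to cancel the 2 in front of \<open>near_multiple_sum\<close>.\<close>
    also have "\<dots> \<le> 1 / 2 * (1 / 2 ^ i)" by (simp add: V_def field_simps)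
    finally have decay: "(6 * V) powr K / (6 * V) ^ j \<le> 1 / 2 * (1 / 2 ^ i)" .
    have "1 / V ^ j * (2 * near_multiple_sum N a R V) \<le> 1 / V ^ j * (2 * (\<epsilon> * ((6 * V) powr K * b)))"
      using V1 V[of V] by (intro mult_left_mono) auto
    also have "\<dots> = 2 * 6 ^ j * \<epsilon> * b * ((6 * V) powr K / (6 * V) ^ j)"
      using V1 by (simp add: power_mult_distrib)
    also have "\<dots> \<le> 2 * 6 ^ j * \<epsilon> * b * (1 / 2 * (1 / 2 ^ i))"
      using assms(4,5) by (intro mult_left_mono decay) auto
    finally show "1 / (2 ^ i / 2) ^ j * (2 * near_multiple_sum N a R (2 ^ i / 2)) \<le> 6 ^ j * \<epsilon> * b * (1 / 2 ^ i)"
      by (simp add: V_def)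
  qed
  also have "\<dots> = 6 ^ j * \<epsilon> * b * (\<Sum>i\<le>L. 1 / 2 ^ i)" by (simp add: sum_distrib_left)
  also have "\<dots> \<le> 6 ^ j * \<epsilon> * b * 2"
    using assms(4,5) by (intro mult_left_mono sum_inverse_two_powers_le) auto
  finally show ?thesis by (simp add: mult_ac)
qed

section \<open>Diagonal terms\<close>

text \<open>Each divisor \<open>d\<close> of \<open>n\<close> is paired with the single
  \<open>k = n div d\<close>, and \<open>n \<le> N \<le> D\<close> ensures that both ranges are long
  enough.\<close>

lemma sum_divisors_eq:
  fixes f :: "nat \<Rightarrow> complex"
  assumes "n \<in> {1..N}" and "N \<le> D"
  shows "(\<Sum>d=1..D. \<Sum>k\<in>{k\<in>{1..N}. d * k = n}. f d) = (\<Sum>d\<in>{d. d dvd n}. f d)"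
proof -
  have "(\<Sum>k\<in>{k\<in>{1..N}. d * k = n}. f d) = (if d dvd n then f d else 0)" if "d \<in> {1..D}" for d
  proof (cases "d dvd n")
    case True
    moreover have "n div d \<le> N" using assms(1) le_trans[OF div_le_dividend[of n d]] by simp
    ultimately have "{k\<in>{1..N}. d * k = n} = {n div d}"
      using that assms(1) by (auto simp: dvd_div_eq_0_iff Suc_le_eq elim: dvdE)
    then show ?thesis using True by simp
  next
    case False
    then have "{k\<in>{1..N}. d * k = n} = {}" by auto
    then show ?thesis using False by (simp only: sum.empty if_False)
  qed
  then have "(\<Sum>d=1..D. \<Sum>k\<in>{k\<in>{1..N}. d * k = n}. f d) = (\<Sum>d=1..D. if d dvd n then f d else 0)"
    by (rule sum.cong[OF refl])
  also have "\<dots> = (\<Sum>d\<in>{d\<in>{1..D}. d dvd n}. f d)"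
    by (rule sum.inter_filter[symmetric]) simp
  also have "{d\<in>{1..D}. d dvd n} = {d. d dvd n}"
    using assms dvd_imp_le[of _ n] by (auto simp: Suc_le_eq intro: Nat.gr0I le_trans)
  finally show ?thesis .
qed

text \<open>If \<open>d * k = n\<close> then \<open>d \<le> N \<le> R / 4\<close>, so the argument
  \<open>R / d * t\<close> is at least 4 and the cutoff equals 1 on the whole range. The phase
  vanishes as well, and every term carries the same integral of \<open>p\<close>.\<close>

lemma diagonal_eq:
  assumes "\<And>x. x > 2 \<Longrightarrow> \<phi> x = 1" and R: "R \<ge> 4 * real N" and "R > 0"
  shows "(\<Sum>d=1..nat \<lfloor>2 * R\<rfloor>. \<Sum>n=1..N. \<Sum>k\<in>{k\<in>{1..N}. d * k = n}. f d * a n *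
       (of_real R * osc_integral \<phi> p (R / real d) (R * (real n / real d - real k)))) =
    of_real (R * integral {1..2} (poly p)) * Bsum f N a"
proof -
  define D where "D = nat \<lfloor>2 * R\<rfloor>"
  have "N \<le> D" unfolding D_def using R by (intro le_nat_floor) simp
  have "(\<Sum>d=1..D. \<Sum>n=1..N. \<Sum>k\<in>{k\<in>{1..N}. d * k = n}. f d * a n *
       (of_real R * osc_integral \<phi> p (R / real d) (R * (real n / real d - real k)))) =
     (\<Sum>d=1..D. \<Sum>n=1..N. \<Sum>k\<in>{k\<in>{1..N}. d * k = n}. of_real (R * integral {1..2} (poly p)) * (a n * f d))"
  proof (intro sum.cong refl)
    fix d n k assume dnk: "d \<in> {1..D}" "n \<in> {1..N}" "k \<in> {k\<in>{1..N}. d * k = n}"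
    have "d \<le> N" using dnk by (auto intro: le_trans[of d "d * k"])
    then have "real d * 4 \<le> R" using R by (simp add: mult.commute order_trans[of "4 * real d" "4 * real N"])
    then have "R / real d \<ge> 4" using dnk by (simp add: field_simps)
    have "osc_integral \<phi> p (R / real d) 0 = integral {1..2} (\<lambda>t. complex_of_real (poly p t))"
      unfolding osc_integral_def
    proof (rule integral_cong)
      fix t :: real assume "t \<in> {1..2}"
      then have "R / real d * 1 \<le> R / real d * t"
        using \<open>R > 0\<close> by (intro mult_left_mono) auto
      then have "\<phi> (R / real d * t) = 1" using \<open>R / real d \<ge> 4\<close> by (intro assms(1)) simp
      then show "complex_of_real (\<phi> (R / real d * t) * poly p t) * ee (0 * t) = complex_of_real (poly p t)"
        by (simp add: ee_def)
    qed
    also have "\<dots> = of_real (integral {1..2} (poly p))"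
      by (intro integral_unique has_integral_of_real integrable_integral integrable_continuous_real continuous_intros)
    finally have "osc_integral \<phi> p (R / real d) 0 = of_real (integral {1..2} (poly p))" .
    moreover have "R * (real n / real d - real k) = 0" using dnk by (auto simp: field_simps)
    ultimately have "osc_integral \<phi> p (R / real d) (R * (real n / real d - real k)) =
        of_real (integral {1..2} (poly p))" by (simp only:)
    then show "f d * a n * (of_real R * osc_integral \<phi> p (R / real d) (R * (real n / real d - real k))) =
        of_real (R * integral {1..2} (poly p)) * (a n * f d)" by (simp add: mult_ac)
  qed
  also have "\<dots> = (\<Sum>n=1..N. \<Sum>d=1..D. \<Sum>k\<in>{k\<in>{1..N}. d * k = n}. of_real (R * integral {1..2} (poly p)) * (a n * f d))"
    by (rule sum.swap)
  also have "\<dots> = of_real (R * integral {1..2} (poly p)) * (\<Sum>n=1..N. a n * (\<Sum>d=1..D. \<Sum>k\<in>{k\<in>{1..N}. d * k = n}. f d))"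
    unfolding sum_distrib_left ..
  also have "(\<Sum>n=1..N. a n * (\<Sum>d=1..D. \<Sum>k\<in>{k\<in>{1..N}. d * k = n}. f d)) = Bsum f N a"
    unfolding Bsum_def bcoef_def using \<open>N \<le> D\<close>
    by (intro sum.cong refl arg_cong2[of _ _ _ _ "(*)"] sum_divisors_eq) auto
  finally show ?thesis unfolding D_def .
qed

section \<open>Cauchy-Schwarz inequality and positivity of the bump weight\<close>

text \<open>The Cauchy-Schwarz inequality in additive form: it follows pointwise from a square being
  nonnegative, and a suitable choice of \<open>s\<close> replaces taking square roots.\<close>

lemma weighted_Cauchy_Schwarz_integral:
  fixes u v :: "real \<Rightarrow> complex"
  assumes "continuous_on {a..b} u" "continuous_on {a..b} v" and "s > 0"
  shows "2 * cmod (integral {a..b} (\<lambda>x. u x * v x)) \<le>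
    s * integral {a..b} (\<lambda>x. (cmod (u x))\<^sup>2) + integral {a..b} (\<lambda>x. (cmod (v x))\<^sup>2) / s"
proof -
  let ?h = "\<lambda>x. s / 2 * (cmod (u x))\<^sup>2 + 1 / (2 * s) * (cmod (v x))\<^sup>2"
  have "cmod (integral {a..b} (\<lambda>x. u x * v x)) \<le> integral {a..b} ?h"
  proof (rule integral_norm_bound_integral)
    fix x
    have "0 \<le> (s * cmod (u x) - cmod (v x))\<^sup>2 / (2 * s)" using assms(3) by simp
    also have "\<dots> = ?h x - cmod (u x) * cmod (v x)"
      using assms(3) by (simp add: field_simps power2_eq_square)
    finally show "cmod (u x * v x) \<le> ?h x" by (simp add: norm_mult)
  qed (use assms in \<open>auto intro!: integrable_continuous_real continuous_intros\<close>)
  also have "integral {a..b} ?h =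
      s / 2 * integral {a..b} (\<lambda>x. (cmod (u x))\<^sup>2) + 1 / (2 * s) * integral {a..b} (\<lambda>x. (cmod (v x))\<^sup>2)"
    by (intro integral_unique has_integral_add has_integral_mult_right integrable_integral
        integrable_continuous_real continuous_intros assms)
  finally show ?thesis by (simp add: field_simps)
qed

lemma poly_bump: "poly (([:-1, 1:] * [:2, -1:]) ^ j) t = ((t - 1) * (2 - t)) ^ j" for t :: real
  by (simp add: algebra_simps)

lemma poly_bump_bounds:
  fixes t :: real
  assumes "t \<in> {1..2}"
  shows "0 \<le> poly (([:-1, 1:] * [:2, -1:]) ^ j) t" "poly (([:-1, 1:] * [:2, -1:]) ^ j) t \<le> 1"
proof -
  have "0 \<le> (t - 1) * (2 - t)" using assms by simp
  moreover have "(t - 1) * (2 - t) \<le> 1 * 1" using assms by (intro mult_mono) auto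
  ultimately show "0 \<le> poly (([:-1, 1:] * [:2, -1:]) ^ j) t" "poly (([:-1, 1:] * [:2, -1:]) ^ j) t \<le> 1"
    unfolding poly_bump by (auto intro: power_le_one)
qed

lemma integral_bump_pos: "integral {1..2} (poly (([:-1, 1:] * [:2, -1:]) ^ j)) > (0::real)"
proof -
  let ?p = "([:-1, 1:] * [:2, -1:]) ^ j :: real poly"
  have cont: "continuous_on (cbox 1 2) (poly ?p)" by (intro continuous_intros)
  have "integral {1..2} (poly ?p) \<ge> 0"
    by (intro integral_nonneg integrable_continuous_real continuous_intros poly_bump_bounds)
  moreover have "integral {1..2} (poly ?p) \<noteq> 0"
  proof
    assume "integral {1..2} (poly ?p) = 0"
    then have "(poly ?p has_integral 0) (cbox 1 2)"
      using cont by (metis cbox_interval integrable_continuous integrable_integral)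
    \<comment> \<open>A continuous nonnegative function with integral 0 vanishes identically, but
      the bump equals \<open>(1/4) ^ j\<close> at the midpoint.\<close>
    then have "poly ?p (3/2) = 0"
      using cont poly_bump_bounds by (intro has_integral_0_cbox_imp_0[of 1 2 "poly ?p"]) auto
    then show False unfolding poly_bump by simp
  qed
  ultimately show ?thesis by simp
qed

section \<open>The mean square bound at a fixed \<open>R\<close>\<close>

text \<open>The final constant depends only on the bump, not on \<open>R\<close>, \<open>N\<close>
  or \<open>a\<close>. The second condition on \<open>\<epsilon>\<close> makes the off-diagonal
  terms at most half of the diagonal ones.\<close>

lemma integral_Gsum_lower_bound:
  fixes K \<epsilon> C M R :: real and j N :: nat
  defines "p \<equiv> ([:-1, 1:] * [:2, -1:]) ^ j"
  assumes \<phi>: "smooth \<phi>" "\<And>x. x < 1 \<Longrightarrow> \<phi> x = 0" "\<And>x. x > 2 \<Longrightarrow> \<phi> x = 1"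
    and R: "R \<ge> 1" "R \<ge> 4 * real N" and N: "1 \<le> N"
    and M: "\<And>d. d \<ge> 1 \<Longrightarrow> cmod (f d) \<le> M"
    and C: "C \<ge> 0" "\<And>s \<theta>. s > 0 \<Longrightarrow> \<theta> \<noteq> 0 \<Longrightarrow> cmod (osc_integral \<phi> p s \<theta>) \<le> C * (1 / \<bar>\<theta>\<bar> ^ j)"
    and j: "K + 1 \<le> real j"
    and \<epsilon>: "\<epsilon> \<ge> 0" "M * C * (2 * 6 ^ j * \<epsilon>) \<le> integral {1..2} (poly p) / 2"
    and V: "\<And>V. V > 1/6 \<Longrightarrow> near_multiple_sum N a R V \<le> \<epsilon> * ((6 * V) powr K * cmod (Bsum f N a))"
  shows "R * (cmod (Bsum f N a))\<^sup>2 / real N \<le>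
    12 / (integral {1..2} (poly p))\<^sup>2 * integral {R..2*R} (\<lambda>x. (cmod (Gsum f \<phi> N a x))\<^sup>2)"
\<comment> \<open>The weight \<open>s\<close> chosen below divides by
  \<open>cmod (Bsum f N a)\<close>, so a vanishing sum is treated apart.\<close>
proof (cases "Bsum f N a = 0")
  case True
  have "0 \<le> integral {R..2*R} (\<lambda>x. (cmod (Gsum f \<phi> N a x))\<^sup>2)"
    by (intro integral_nonneg integrable_continuous_real continuous_intros continuous_on_Gsum \<phi>) auto
  then show ?thesis using True by simp
next
  case False
  define b where "b = cmod (Bsum f N a)"
  define c where "c = integral {1..2} (poly p)"
  define D where "D = nat \<lfloor>2 * R\<rfloor>"
  define X where "X = integral {R..2*R} (\<lambda>x. (cmod (Gsum f \<phi> N a x))\<^sup>2)"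
  define T where "T d n k = f d * a n *
       (of_real R * osc_integral \<phi> p (R / real d) (R * (real n / real d - real k)))" for d n k :: nat
  let ?v = "\<lambda>x. complex_of_real (poly p (x / R)) * (\<Sum>k=1..N. ee (- (real k * x)))"
  let ?I = "integral {R..2*R} (\<lambda>x. Gsum f \<phi> N a x * ?v x)"
  have b: "b > 0" using False by (simp add: b_def)
  have c: "c > 0" unfolding c_def p_def by (rule integral_bump_pos)
  have M0: "M \<ge> 0" using M[of 1] norm_ge_zero[of "f 1"] by linarith
  have R0: "R > 0" using R by simp
  have "?I = (\<Sum>d=1..D. \<Sum>n=1..N. \<Sum>k=1..N. T d n k)"
    unfolding D_def T_def by (rule integral_Gsum_kernel) (use \<phi> R0 in auto)
  also have "\<dots> = (\<Sum>d=1..D. \<Sum>n=1..N. (\<Sum>k\<in>{k\<in>{1..N}. d * k = n}. T d n k) + (\<Sum>k\<in>{k\<in>{1..N}. d * k \<noteq> n}. T d n k))"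
  proof (intro sum.cong refl)
    fix d n
    have "(\<Sum>k\<in>{k\<in>{1..N}. d * k = n} \<union> {k\<in>{1..N}. d * k \<noteq> n}. T d n k) =
        (\<Sum>k\<in>{k\<in>{1..N}. d * k = n}. T d n k) + (\<Sum>k\<in>{k\<in>{1..N}. d * k \<noteq> n}. T d n k)"
      by (rule sum.union_disjoint) auto
    moreover have "{k\<in>{1..N}. d * k = n} \<union> {k\<in>{1..N}. d * k \<noteq> n} = {1..N}" by blast
    ultimately show "(\<Sum>k=1..N. T d n k) =
        (\<Sum>k\<in>{k\<in>{1..N}. d * k = n}. T d n k) + (\<Sum>k\<in>{k\<in>{1..N}. d * k \<noteq> n}. T d n k)" by (simp only:)
  qed
  also have "\<dots> = (\<Sum>d=1..D. \<Sum>n=1..N. \<Sum>k\<in>{k\<in>{1..N}. d * k = n}. T d n k)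
      + (\<Sum>d=1..D. \<Sum>n=1..N. \<Sum>k\<in>{k\<in>{1..N}. d * k \<noteq> n}. T d n k)"
    by (simp only: sum.distrib)
  also have "(\<Sum>d=1..D. \<Sum>n=1..N. \<Sum>k\<in>{k\<in>{1..N}. d * k = n}. T d n k) = of_real (R * c) * Bsum f N a"
    unfolding D_def T_def c_def by (rule diagonal_eq) (use \<phi> R R0 in auto)
  finally have I: "?I = of_real (R * c) * Bsum f N a + (\<Sum>d=1..D. \<Sum>n=1..N. \<Sum>k\<in>{k\<in>{1..N}. d * k \<noteq> n}. T d n k)" .
  have "cmod (\<Sum>d=1..D. \<Sum>n=1..N. \<Sum>k\<in>{k\<in>{1..N}. d * k \<noteq> n}. T d n k) \<le>
      (\<Sum>d=1..D. \<Sum>n=1..N. \<Sum>k\<in>{k\<in>{1..N}. d * k \<noteq> n}. R * M * C * (cmod (a n) * (1 / \<bar>R * (real n / real d - real k)\<bar> ^ j)))"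
  proof (intro sum_norm_le)
    fix d n k assume dnk: "d \<in> {1..D}" "n \<in> {1..N}" "k \<in> {k\<in>{1..N}. d * k \<noteq> n}"
    let ?\<theta> = "R * (real n / real d - real k)"
    have "real n \<noteq> real (d * k)" using dnk by (simp only: of_nat_eq_iff) auto
    then have "?\<theta> \<noteq> 0" using dnk R0 by (auto simp: field_simps)
    then have "cmod (osc_integral \<phi> p (R / real d) ?\<theta>) \<le> C * (1 / \<bar>?\<theta>\<bar> ^ j)"
      using dnk R0 by (intro C(2)) auto
    moreover have "cmod (f d) \<le> M" using dnk by (intro M) auto
    ultimately have "cmod (f d) * cmod (a n) * (R * cmod (osc_integral \<phi> p (R / real d) ?\<theta>)) \<le>
        M * cmod (a n) * (R * (C * (1 / \<bar>?\<theta>\<bar> ^ j)))"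
      using M0 R0 by (intro mult_mono mult_right_mono mult_left_mono) auto
    then show "cmod (T d n k) \<le> R * M * C * (cmod (a n) * (1 / \<bar>?\<theta>\<bar> ^ j))"
      unfolding T_def norm_mult norm_of_real using R0 by (simp add: mult_ac)
  qed
  also have "\<dots> = R * M * C * (\<Sum>d=1..D. \<Sum>n=1..N. \<Sum>k\<in>{k\<in>{1..N}. d * k \<noteq> n}. cmod (a n) * (1 / \<bar>R * (real n / real d - real k)\<bar> ^ j))"
    unfolding sum_distrib_left ..
  also have "\<dots> \<le> R * M * C * (2 * 6 ^ j * \<epsilon> * b)"
  proof (intro mult_left_mono off_diagonal_le[where K = K])
    show "real D \<le> 2 * R" unfolding D_def using R0 by (simp add: of_nat_floor)
  qed (use R0 M0 C(1) j \<epsilon>(1) b V in \<open>auto simp: b_def\<close>)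
  also have "\<dots> = R * b * (M * C * (2 * 6 ^ j * \<epsilon>))" by simp
  also have "\<dots> \<le> R * b * (c / 2)"
    using \<epsilon>(2) R0 b by (intro mult_left_mono) (auto simp: c_def)
  finally have off: "cmod (\<Sum>d=1..D. \<Sum>n=1..N. \<Sum>k\<in>{k\<in>{1..N}. d * k \<noteq> n}. T d n k) \<le> R * b * (c / 2)" .
  \<comment> \<open>The diagonal has modulus \<open>R * c * b\<close>, and at most half of it is
    lost to the other terms.\<close>
  have "R * c * b = cmod (of_real (R * c) * Bsum f N a)"
    using R0 c by (simp add: norm_mult b_def)
  also have "\<dots> \<le> cmod ?I + cmod (\<Sum>d=1..D. \<Sum>n=1..N. \<Sum>k\<in>{k\<in>{1..N}. d * k \<noteq> n}. T d n k)"
    unfolding I by (rule norm_triangle_ineq4[of "x + y" y for x y :: complex, simplified])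
  finally have lower: "R * c * b \<le> 2 * cmod ?I"
    using off by (simp add: field_simps)
  \<comment> \<open>With this weight the kernel's share of the Cauchy-Schwarz bound is half of the lower bound for the integral.\<close>
  define s where "s = 6 * real N / (c * b)"
  have s: "s > 0" using N c b by (simp add: s_def)
  have cont_v: "continuous_on {R..2*R} ?v" by (intro continuous_intros) (use R0 in auto)
  have "integral {R..2*R} (\<lambda>x. (cmod (?v x))\<^sup>2) \<le> integral {R..2*R} (\<lambda>x. (cmod (\<Sum>k=1..N. ee (- (real k * x))))\<^sup>2)"
  proof (rule integral_le)
    fix x assume "x \<in> {R..2*R}"
    then have "x / R \<in> {1..2}" using R0 by (auto simp: field_simps)
    then have "\<bar>poly p (x / R)\<bar> \<le> 1" unfolding p_def by (subst abs_of_nonneg) (rule poly_bump_bounds, assumption)+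
    then have "cmod (?v x) \<le> 1 * cmod (\<Sum>k=1..N. ee (- (real k * x)))"
      unfolding norm_mult norm_of_real by (intro mult_right_mono) auto
    then show "(cmod (?v x))\<^sup>2 \<le> (cmod (\<Sum>k=1..N. ee (- (real k * x))))\<^sup>2"
      by (intro power_mono) auto
  qed (intro integrable_continuous_real continuous_intros cont_v)+
  also have "\<dots> \<le> 3 * R * real N" by (rule integral_dirichlet_kernel_le) fact
  finally have "integral {R..2*R} (\<lambda>x. (cmod (?v x))\<^sup>2) / s \<le> 3 * R * real N / s"
    using s by (intro divide_right_mono) auto
  also have "\<dots> = R * c * b / 2" unfolding s_def using N c b by (simp add: field_simps)
  finally have "integral {R..2*R} (\<lambda>x. (cmod (?v x))\<^sup>2) / s \<le> R * c * b / 2" .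
  moreover have "2 * cmod ?I \<le> s * X + integral {R..2*R} (\<lambda>x. (cmod (?v x))\<^sup>2) / s"
    unfolding X_def by (intro weighted_Cauchy_Schwarz_integral continuous_on_Gsum \<phi> cont_v s)
  \<comment> \<open>The kernel's share \<open>R * c * b / 2\<close> is absorbed on the left, which
    doubles the factor of \<open>s * X\<close>.\<close>
  ultimately have "R * c * b \<le> 2 * (s * X)" using lower by linarith
  also have "\<dots> = 12 * real N * X / (c * b)" by (simp add: s_def)
  finally have "R * b\<^sup>2 / real N \<le> 12 / c\<^sup>2 * X"
    using N c b by (simp add: field_simps power2_eq_square)
  then show ?thesis unfolding b_def c_def X_def .
qed

section \<open>Passage to the asymptotic statements\<close>

text \<open>Uniformity in \<open>V\<close> and in \<open>x\<close> is expressed by filters on pairs.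
  The premise that \<open>Bsum\<close> is nonzero for arbitrarily large \<open>R\<close> excludes
  the choice \<open>a = 0\<close>, for which both sides of the second claim vanish and the little-o
  relation holds.\<close>

theorem theorem2p3:
  fixes f :: "nat \<Rightarrow> complex" and \<phi> :: "real \<Rightarrow> real" and K :: real
    and N :: "real \<Rightarrow> nat" and a :: "real \<Rightarrow> nat \<Rightarrow> complex"
  assumes "bounded (f ` {1..})"
    and "smooth \<phi>"
    and "\<And>x. x < 1 \<Longrightarrow> \<phi> x = 0"
    and "\<And>x. x > 2 \<Longrightarrow> \<phi> x = 1"
    and "\<forall>\<^sub>F R in at_top. 1 \<le> N R \<and> R \<ge> 4 * real (N R)"
    and "\<forall>\<^sub>F R in at_top. \<forall>n\<in>{1..N R}. bcoef f (a R) n \<in> \<real>\<^sub>\<ge>\<^sub>0"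
    and "K > 1"
    and "(\<lambda>(R, V). near_multiple_sum (N R) (a R) R V)
           \<in> o[unif_at_top (\<lambda>R. {1/6<..})](\<lambda>(R, V). (6 * V) powr K * cmod (Bsum f (N R) (a R)))"
  shows "(\<lambda>R. R * (cmod (Bsum f (N R) (a R)))\<^sup>2 / real (N R))
           \<in> O[at_top](\<lambda>R. integral {R..2*R} (\<lambda>x. (cmod (Gsum f \<phi> (N R) (a R) x))\<^sup>2))
    \<and> ((\<exists>\<^sub>F R in at_top. Bsum f (N R) (a R) \<noteq> 0) \<longrightarrow>
         (\<lambda>(R, x). Gsum f \<phi> (N R) (a R) x)
           \<notin> o[unif_at_top (\<lambda>R. {R..2*R})](\<lambda>(R, x). Bsum f (N R) (a R) / of_real (sqrt (real (N R)))))"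
proof -
  \<comment> \<open>One power beyond \<open>K\<close> makes the contribution of the shell
    \<open>V\<close> decay like \<open>1 / V\<close>.\<close>
  define j where "j = nat \<lceil>K + 1\<rceil>"
  define p :: "real poly" where "p = ([:-1, 1:] * [:2, -1:]) ^ j"
  define c where "c = integral {1..2} (poly p)"
  define A where "A = 12 / c\<^sup>2"
  let ?X = "\<lambda>R. integral {R..2*R} (\<lambda>x. (cmod (Gsum f \<phi> (N R) (a R) x))\<^sup>2)"
  let ?B = "\<lambda>R. Bsum f (N R) (a R)"
  have j: "K + 1 \<le> real j" unfolding j_def by linarith
  have c: "c > 0" unfolding c_def p_def by (rule integral_bump_pos)
  have A: "A > 0" using c by (simp add: A_def)
  obtain M where M: "\<And>d. d \<ge> 1 \<Longrightarrow> cmod (f d) \<le> M"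
    using assms(1) by (auto simp: bounded_iff)
  have M0: "M \<ge> 0" using M[of 1] norm_ge_zero[of "f 1"] by linarith
  obtain C where C: "C \<ge> 0" "\<And>s \<theta>. s > 0 \<Longrightarrow> \<theta> \<noteq> 0 \<Longrightarrow> cmod (osc_integral \<phi> p s \<theta>) \<le> C * (1 / \<bar>\<theta>\<bar> ^ j)"
    using oscillatory_integral_bound[of \<phi> j p 0, OF assms(2-4)]
    unfolding osc_integral_def p_def by auto
  \<comment> \<open>Chosen so that the off-diagonal terms cost at most \<open>c / 2\<close>; the 1
    guards against \<open>M * C = 0\<close>.\<close>
  define \<epsilon> where "\<epsilon> = c / (4 * 6 ^ j * (M * C + 1))"
  have MC: "M * C \<ge> 0" using M0 C(1) by simp
  have \<epsilon>: "\<epsilon> > 0" unfolding \<epsilon>_def using c MC by (intro divide_pos_pos mult_pos_pos) auto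
  have "(M * C + 1) * (2 * 6 ^ j * \<epsilon>) = c / 2" unfolding \<epsilon>_def using MC by (simp add: divide_simps)
  moreover have "M * C * (2 * 6 ^ j * \<epsilon>) \<le> (M * C + 1) * (2 * 6 ^ j * \<epsilon>)"
    using \<epsilon> by (intro mult_right_mono) auto
  ultimately have \<epsilon>2: "M * C * (2 * 6 ^ j * \<epsilon>) \<le> c / 2" by linarith
  \<comment> \<open>One fixed \<open>\<epsilon>\<close> must serve all \<open>V\<close> at once, as
    the number of dyadic shells is not bounded in \<open>R\<close>.\<close>
  have "\<forall>\<^sub>F R in at_top. \<forall>V\<in>{1/6<..}. near_multiple_sum (N R) (a R) R V \<le> \<epsilon> * ((6 * V) powr K * cmod (?B R))"
    using landau_o.smallD[OF assms(8) \<epsilon>] unfolding eventually_unif_at_top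
    by (rule eventually_mono) (rule ballI, drule (1) bspec, simp add: abs_mult)
  then have lower: "\<forall>\<^sub>F R in at_top. R * (cmod (?B R))\<^sup>2 / real (N R) \<le> A * ?X R"
    using assms(5) eventually_ge_at_top[of 1]
  proof eventually_elim
    case (elim R)
    show ?case unfolding A_def c_def p_def
    proof (rule integral_Gsum_lower_bound[OF assms(2-4) _ _ _ M C[unfolded p_def] j _ \<epsilon>2[unfolded c_def p_def]])
      show "near_multiple_sum (N R) (a R) R V \<le> \<epsilon> * ((6 * V) powr K * cmod (?B R))" if "V > 1/6" for V
        using elim(1) that by (intro bspec[OF elim(1)]) simp
    qed (use elim \<epsilon> in auto)
  qed
  have "(\<lambda>R. R * (cmod (?B R))\<^sup>2 / real (N R)) \<in> O[at_top](?X)"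
  proof (rule landau_o.bigI[OF A])
    show "\<forall>\<^sub>F R in at_top. norm (R * (cmod (?B R))\<^sup>2 / real (N R)) \<le> A * norm (?X R)"
      using lower eventually_ge_at_top[of 0]
    proof eventually_elim
      case (elim R)
      have "A * ?X R \<le> A * norm (?X R)" using A by (intro mult_left_mono) auto
      then show ?case using elim by simp
    qed
  qed
  moreover have "(\<lambda>(R, x). Gsum f \<phi> (N R) (a R) x)
      \<notin> o[unif_at_top (\<lambda>R. {R..2*R})](\<lambda>(R, x). ?B R / of_real (sqrt (real (N R))))"
    if freq: "\<exists>\<^sub>F R in at_top. ?B R \<noteq> 0"
  proof
    assume small: "(\<lambda>(R, x). Gsum f \<phi> (N R) (a R) x)
      \<in> o[unif_at_top (\<lambda>R. {R..2*R})](\<lambda>(R, x). ?B R / of_real (sqrt (real (N R))))"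
    \<comment> \<open>With \<open>A * \<delta>^2 = 1 / 2\<close>, integrating the pointwise bound
      over length \<open>R\<close> makes the quantity bounded below by \<open>lower\<close> at most
      half of itself, which forces \<open>Bsum\<close> to vanish.\<close>
    define \<delta> where "\<delta> = 1 / sqrt (2 * A)"
    have \<delta>: "\<delta> > 0" "\<delta>\<^sup>2 = 1 / (2 * A)" using A by (simp_all add: \<delta>_def power_divide)
    have "\<forall>\<^sub>F R in at_top. \<forall>x\<in>{R..2*R}. cmod (Gsum f \<phi> (N R) (a R) x) \<le> \<delta> * (cmod (?B R) / sqrt (real (N R)))"
      using landau_o.smallD[OF small \<delta>(1)] unfolding eventually_unif_at_top
      by (rule eventually_mono) (auto simp: norm_divide)
    then have "\<forall>\<^sub>F R in at_top. ?B R = 0"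
      using lower assms(5) eventually_gt_at_top[of 0]
    proof eventually_elim
      case (elim R)
      have "?X R \<le> integral {R..2*R} (\<lambda>x. \<delta>\<^sup>2 * ((cmod (?B R))\<^sup>2 / real (N R)))"
      proof (rule integral_le)
        fix x assume "x \<in> {R..2*R}"
        then have "(cmod (Gsum f \<phi> (N R) (a R) x))\<^sup>2 \<le> (\<delta> * (cmod (?B R) / sqrt (real (N R))))\<^sup>2"
          using elim(1) by (intro power_mono) auto
        then show "(cmod (Gsum f \<phi> (N R) (a R) x))\<^sup>2 \<le> \<delta>\<^sup>2 * ((cmod (?B R))\<^sup>2 / real (N R))"
          by (simp add: power_mult_distrib power_divide)
      qed (rule integrable_continuous_real, intro continuous_on_const continuous_intros continuous_on_Gsum assms(2,3), assumption?)+
      also have "\<dots> = 1 / (2 * A) * (R * (cmod (?B R))\<^sup>2 / real (N R))"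
        using elim by (simp add: \<delta>)
      finally have "A * ?X R \<le> A * (1 / (2 * A) * (R * (cmod (?B R))\<^sup>2 / real (N R)))"
        using A by (intro mult_left_mono) auto
      then have "R * (cmod (?B R))\<^sup>2 / real (N R) \<le> 1 / 2 * (R * (cmod (?B R))\<^sup>2 / real (N R))"
        using elim(2) A by simp
      then have "R * (cmod (?B R))\<^sup>2 / real (N R) \<le> 0" by linarith
      then show ?case using elim by (auto simp: divide_le_0_iff mult_le_0_iff)
    qed
    then show False using freq by (simp add: frequently_def)
  qed
  ultimately show ?thesis by blast
qed

end
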